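(* Let $n\geq 1$. Let $\mathrm{FR}_n^{\uparrow}$ denote the set of weakly increasing Fubini rankings of length $n$ and let $\mathrm{FR}_n^{\downarrow}$ denote the set of weakly decreasing Fubini rankings of length $n$. Then $$|\mathrm{FR}_n^{\uparrow}|=|\mathrm{FR}_n^{\downarrow}|=2^{n-1}.$$
   Context: Let $[n]=\{1,2,\ldots,n\}$. A Fubini ranking of length $n$ is a tuple $r=(r_1,\ldots,r_n)\in[n]^n$ that records a valid ranking of $n$ competitors with ties allowed, where if exactly $k$ competitors are tied at rank $i$, then the next $k-1$ ranks $i+1,\ldots,i+k-1$ are disallowed; equivalently, $r_i=1+|\{j : r_j<r_i\}|$ for every $i\in[n]$. A tuple is weakly increasing if $r_i\le r_{i+1}$ for all $i\in[n-1]$, and weakly decreasing if $r_i\ge r_{i+1}$ for all $i\in[n-1]$. *)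

theory Defs
  imports Main
begin

text \<open>
  The tuple $(r_1,\ldots,r_n)$ is the list \<open>r\<close> of length \<open>n\<close>: positions are counted from 0,
  so $r_{i+1}$ is \<open>r ! i\<close>, while the entries themselves are ranks in \<open>{1..n}\<close>.
  The rule for ties is not by itself the definition: for instance \<open>[2, 2]\<close> obeys it vacuously
  although nobody is ranked first. A valid ranking gives each competitor the rank
  one plus the number of strictly better ones; \<open>fubini_ranking_ties\<close> below recovers the rule for ties.
\<close>

definition fubini_ranking :: "nat \<Rightarrow> nat list \<Rightarrow> bool" where
  "fubini_ranking n r \<longleftrightarrow>
     length r = n \<and> set r \<subseteq> {1..n} \<and>
     (\<forall>i<n. r ! i = 1 + card {j. j < n \<and> r ! j < r ! i})"

definition FR_up :: "nat \<Rightarrow> nat list set" where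
  "FR_up n = {r. fubini_ranking n r \<and> sorted r}"

definition FR_down :: "nat \<Rightarrow> nat list set" where
  "FR_down n = {r. fubini_ranking n r \<and> sorted_wrt (\<ge>) r}"

lemma fubini_ranking_ties:
  assumes r: "fubini_ranking n r" and i: "i \<in> set r"
    and m: "i < m" "m < i + card {j. j < n \<and> r ! j = i}"
  shows "m \<notin> set r"
proof
  assume "m \<in> set r"
  then obtain b where b: "b < n" "r ! b = m"
    using r by (auto simp: fubini_ranking_def in_set_conv_nth)
  obtain a where a: "a < n" "r ! a = i"
    using r i by (auto simp: fubini_ranking_def in_set_conv_nth)
  let ?L = "{j. j < n \<and> r ! j < i}" and ?E = "{j. j < n \<and> r ! j = i}"
  have "card ?L + card ?E = card (?L \<union> ?E)"
    by (rule card_Un_disjoint [symmetric]) auto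
  also have "\<dots> \<le> card {j. j < n \<and> r ! j < m}"
    using m by (intro card_mono) auto
  finally have "card ?L + card ?E \<le> card {j. j < n \<and> r ! j < m}" .
  moreover have "i = 1 + card ?L" "m = 1 + card {j. j < n \<and> r ! j < m}"
    using r a b by (auto simp: fubini_ranking_def)
  ultimately show False using m by linarith
qed

end

theory Submission
  imports Defs
begin

text \<open>
  A weakly increasing Fubini ranking is built by adding competitors from best to worst. A competitor
  that is no better than anybody present leaves all previous ranks valid, and has only two
  possibilities: tie with the competitor who is currently last, hence share that rank, or be strictly
  worse than all \<open>n\<close> others, hence get rank \<open>n + 1\<close>. As ranks among \<open>n\<close> competitors
  are at most \<open>n\<close>, the two outcomes differ, so each new competitor after the first doubles the
  number of rankings (\<open>FR_up_Suc\<close> and \<open>card_FR_up\<close>). Being a Fubini ranking does not depend on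
  the order in which the competitors are listed, so list reversal maps the increasing rankings
  bijectively to the decreasing ones (\<open>FR_down_eq_rev_FR_up\<close>).
\<close>

text \<open>
  Counting entries by filtering the list makes independence of the order visible. The bounds on the
  ranks come for free: an entry is never strictly smaller than itself, so fewer than \<open>n\<close>
  entries are counted.
\<close>

lemma fubini_ranking_iff_filter:
  "fubini_ranking n r \<longleftrightarrow>
     length r = n \<and> (\<forall>x\<in>set r. x = Suc (length (filter (\<lambda>y. y < x) r)))"
proof -
  have "set r \<subseteq> {1..length r}" if "\<forall>x\<in>set r. x = Suc (length (filter (\<lambda>y. y < x) r))"
  proof
    fix x assume x: "x \<in> set r"
    then have "length (filter (\<lambda>y. y < x) r) < length r"
      by (rule length_filter_less) simp
    moreover have "x = Suc (length (filter (\<lambda>y. y < x) r))"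
      using that x by blast
    ultimately show "x \<in> {1..length r}" by simp
  qed
  moreover have "(\<forall>x\<in>set r. x = Suc (length (filter (\<lambda>y. y < x) r))) \<longleftrightarrow>
      (\<forall>i<length r. r ! i = 1 + card {j. j < length r \<and> r ! j < r ! i})"
    by (simp only: all_set_conv_all_nth length_filter_conv_card plus_1_eq_Suc)
  ultimately show ?thesis
    unfolding fubini_ranking_def by blast
qed

lemma fubini_ranking_rev: "fubini_ranking n (rev r) \<longleftrightarrow> fubini_ranking n r"
  by (simp add: fubini_ranking_iff_filter flip: rev_filter)

lemma FR_down_eq_rev_FR_up: "FR_down n = rev ` FR_up n"
proof -
  have "FR_down n = {r. rev r \<in> FR_up n}"
    by (simp add: FR_up_def FR_down_def fubini_ranking_rev sorted_wrt_rev)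
  also have "\<dots> = rev ` FR_up n"
    by (auto intro: image_eqI[where f = rev and x = "rev r" for r])
  finally show ?thesis .
qed

text \<open>
  The new entry \<open>x\<close> is a maximum, so it is never counted as strictly better than anybody and the
  old conditions are unchanged. Its own condition reads \<open>x = last s\<close> in case of a tie and
  \<open>x = Suc n\<close> otherwise.
\<close>

lemma snoc_mem_FR_up_iff:
  assumes "n \<ge> 1"
  shows "s @ [x] \<in> FR_up (Suc n) \<longleftrightarrow> s \<in> FR_up n \<and> (x = last s \<or> x = Suc n)"
proof (cases "length s = n \<and> sorted s")
  case True
  then have len: "length s = n" and srt: "sorted s" and ne: "s \<noteq> []"
    using assms by auto
  have last_max: "y \<le> last s" if "y \<in> set s" for y
    using that srt ne by (cases s rule: rev_cases) (auto simp: sorted_append)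
  have last_in: "last s \<in> set s" using ne by simp
  have above: "filter (\<lambda>y. y < x) s = s" if "last s < x"
    using that last_max by (fastforce intro: filter_True)
  have old: "filter (\<lambda>y. y < z) (s @ [x]) = filter (\<lambda>y. y < z) s"
    if "last s \<le> x" "z \<in> set s \<or> z = x" for z
    using that last_max[of z] by auto
  have srt_snoc: "sorted (s @ [x]) \<longleftrightarrow> last s \<le> x"
    using srt last_max last_in by (auto simp: sorted_append intro: order_trans)
  show ?thesis
  proof (cases "last s \<le> x")
    case le: True
    have snoc: "s @ [x] \<in> FR_up (Suc n) \<longleftrightarrow>
        s \<in> FR_up n \<and> x = Suc (length (filter (\<lambda>y. y < x) s))"
      using len srt srt_snoc le old[OF le]
      by (auto simp: FR_up_def fubini_ranking_iff_filter simp del: filter_append)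
    show ?thesis
    proof (cases "last s = x")
      case tie: True
      then have "x = Suc (length (filter (\<lambda>y. y < x) s))" if "s \<in> FR_up n"
        using that last_in unfolding FR_up_def fubini_ranking_iff_filter by blast
      then show ?thesis using snoc tie by blast
    next
      case False
      then show ?thesis using snoc le above len by auto
    qed
  next
    \<comment> \<open>Now \<open>s @ [x]\<close> is not sorted, and \<open>x < last s \<le> n\<close> if \<open>s\<close> is a ranking: both sides fail.\<close>
    case False
    have "last s \<le> n" if "s \<in> FR_up n"
      using that last_in by (auto simp: FR_up_def fubini_ranking_def)
    then show ?thesis using False srt_snoc by (auto simp: FR_up_def)
  qed
next
  case False
  then show ?thesis
    by (auto simp: FR_up_def fubini_ranking_def sorted_append)
qed

lemma FR_up_Suc:
  assumes "n \<ge> 1"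
  shows "FR_up (Suc n) = (\<lambda>s. s @ [last s]) ` FR_up n \<union> (\<lambda>s. s @ [Suc n]) ` FR_up n"
    (is "_ = ?R")
proof -
  have "r \<in> FR_up (Suc n) \<longleftrightarrow> r \<in> ?R" for r
  proof (cases r rule: rev_cases)
    case Nil
    then show ?thesis by (auto simp: FR_up_def fubini_ranking_def)
  next
    case (snoc s x)
    then show ?thesis using snoc_mem_FR_up_iff[OF assms, of s x] by auto
  qed
  then show ?thesis by blast
qed

lemma FR_up_1: "FR_up (Suc 0) = {[Suc 0]}"
  by (auto simp: FR_up_def fubini_ranking_iff_filter length_Suc_conv)

lemma card_FR_up:
  assumes "n \<ge> 1"
  shows "finite (FR_up n) \<and> card (FR_up n) = 2 ^ (n - 1)"
  using assms
proof (induction n rule: nat_induct_at_least)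
  case base
  then show ?case by (simp add: FR_up_1)
next
  case (Suc n)
  let ?tie = "\<lambda>s :: nat list. s @ [last s]" and ?worse = "\<lambda>s. s @ [Suc n]"
  have "last s \<noteq> Suc n" if "s \<in> FR_up n" for s
  proof -
    have "s \<noteq> []" "set s \<subseteq> {1..n}"
      using that Suc.hyps by (auto simp: FR_up_def fubini_ranking_def)
    then show ?thesis using last_in_set by fastforce
  qed
  then have disj: "?tie ` FR_up n \<inter> ?worse ` FR_up n = {}" by auto
  have "inj_on ?tie (FR_up n)" "inj_on ?worse (FR_up n)"
    by (auto intro: inj_onI)
  then have "card (FR_up (Suc n)) = 2 * card (FR_up n)"
    using Suc.IH disj by (simp add: FR_up_Suc[OF Suc.hyps] card_Un_disjoint card_image)
  also have "\<dots> = 2 ^ (Suc n - 1)"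
    using Suc by (simp flip: power_Suc)
  finally show ?case
    using Suc.IH by (simp add: FR_up_Suc[OF Suc.hyps])
qed

theorem lemma2p1:
  fixes n :: nat
  assumes "n \<ge> 1"
  shows "card (FR_up n) = card (FR_down n) \<and> card (FR_down n) = 2 ^ (n - 1)"
proof -
  have "card (FR_down n) = card (FR_up n)"
    unfolding FR_down_eq_rev_FR_up by (rule card_image) (simp add: inj_on_def)
  then show ?thesis using card_FR_up[OF assms] by simp
qed

end
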